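(* Let $H_t(z)\in k[[t]]\langle\langle z\rangle\rangle^{\times n}$ with $o(H_t(z))\ge 2$, let $F_t(z)=z-H_t(z)$, let $G_t(z)$ be the inverse map of $F_t(z)$, and let $M_t(z)=G_t(z)-z$. Put $h(t)=\left[\frac{\partial M_t}{\partial t}(F_t)\frac{\partial}{\partial z}\right]$ and $m(t)=\left[\frac{\partial H_t}{\partial t}(G_t)\frac{\partial}{\partial z}\right]$. Then for any $u(z)\in k\langle\langle z\rangle\rangle$, $$\frac{\partial\, u(F_t)}{\partial t}=-(m(t)u)(F_t)=-h(t)\,u(F_t),$$ $$\frac{\partial\, u(G_t)}{\partial t}=(h(t)u)(G_t)=m(t)\,u(G_t).$$
   Context: $k$ is a (commutative) unital integral domain of any characteristic; $n\ge 1$; $z=(z_1,\dots,z_n)$ are noncommutative free variables; $t$ is a formal parameter commuting with $z$. $k\langle\langle z\rangle\rangle$ and $k[[t]]\langle\langle z\rangle\rangle$ are the algebras of formal power series in the noncommuting variables $z_i$ over $k$ and $k[[t]]$. The order $o(U)$ of a vector $U$ is the minimum of the orders (lowest degree in $z$; $t$ counts as a scalar) of its components. An automorphism of $k[[t]]\langle\langle z\rangle\rangle$ over $k[[t]]$ is identified with the vector $F_t=(F_{t,1},\dots,F_{t,n})$ of images of $z_1,\dots,z_n$, and $u(F_t)$ denotes the image of $u$, i.e. the result of substituting $F_{t,i}$ for $z_i$; for vectors this is done componentwise. If $o(H_t)\ge 2$, then $z-H_t$ is an automorphism; its inverse map $G_t$ satisfies $F_t(G_t(z))=z=G_t(F_t(z))$.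 For a vector $\vec u=(u_1,\dots,u_n)$ over $k[[t]]\langle\langle z\rangle\rangle$, $[\vec u\frac{\partial}{\partial z}]$ denotes the unique $k[[t]]$-derivation of $k[[t]]\langle\langle z\rangle\rangle$ sending $z_i$ to $u_i$ for all $i$. $\frac{\partial}{\partial t}$ is the derivation of $k[[t]]\langle\langle z\rangle\rangle$ extending $\frac{\partial}{\partial t}$ on $k[[t]]$ coefficientwise, with $\frac{\partial z_i}{\partial t}=0$; it acts on vectors componentwise. *)

theory Defs
  imports
    "HOL-Computational_Algebra.Formal_Power_Series"
    "HOL-Library.Extended_Nat"
    "HOL-Library.Groups_Big_Fun"
begin

text \<open>
  Formal power series in noncommuting variables indexed by \<^typ>\<open>'v\<close>, with coefficients in
  \<^typ>\<open>'a\<close>: one coefficient for each word, i.e. for each monomial in the free variables.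
  Thus \<^typ>\<open>'v\<close> finite with \<open>n\<close> elements gives \<open>'a\<langle>\<langle>z\<^sub>1,\<dots>,z\<^sub>n\<rangle>\<rangle>\<close>, and vectors of length \<open>n\<close> are
  functions on \<^typ>\<open>'v\<close>. The ring \<open>k[[t]]\<langle>\<langle>z\<rangle>\<rangle>\<close> is obtained by taking \<open>k fps\<close> for \<^typ>\<open>'a\<close>.
\<close>

typedef ('v, 'a) ncfps = "UNIV :: ('v list \<Rightarrow> 'a) set"
  morphisms nc_coeff Abs_ncfps ..

setup_lifting type_definition_ncfps

lemma ncfps_eqI: "(\<And>w. nc_coeff f w = nc_coeff g w) \<Longrightarrow> f = g"
  by transfer auto

instantiation ncfps :: (type, ring_1) ring_1
begin

lift_definition zero_ncfps :: "('a, 'b) ncfps" is "\<lambda>w. 0" .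

lift_definition one_ncfps :: "('a, 'b) ncfps" is "\<lambda>w. if w = [] then 1 else 0" .

lift_definition plus_ncfps :: "('a, 'b) ncfps \<Rightarrow> ('a, 'b) ncfps \<Rightarrow> ('a, 'b) ncfps"
  is "\<lambda>f g w. f w + g w" .

lift_definition minus_ncfps :: "('a, 'b) ncfps \<Rightarrow> ('a, 'b) ncfps \<Rightarrow> ('a, 'b) ncfps"
  is "\<lambda>f g w. f w - g w" .

lift_definition uminus_ncfps :: "('a, 'b) ncfps \<Rightarrow> ('a, 'b) ncfps"
  is "\<lambda>f w. - f w" .

lift_definition times_ncfps :: "('a, 'b) ncfps \<Rightarrow> ('a, 'b) ncfps \<Rightarrow> ('a, 'b) ncfps"
  is "\<lambda>f g w. \<Sum>i=0..length w. f (take i w) * g (drop i w)" .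

instance
proof
  fix f g h :: "('a, 'b) ncfps"
  show "f * g * h = f * (g * h)"
  proof (transfer, rule ext)
    fix f g h :: "'a list \<Rightarrow> 'b" and w :: "'a list"
    let ?c = "\<lambda>i d e. f (take i w) * g (take d (drop i w)) * h (drop (i + d) w)"
    let ?n = "length w"
    have "(\<Sum>j=0..?n. (\<Sum>i=0..length (take j w). f (take i (take j w)) * g (drop i (take j w))) * h (drop j w))
        = (\<Sum>j=0..?n. \<Sum>i=0..j. ?c i (j - i) (?n - j))"
      by (intro sum.cong refl) (auto simp: sum_distrib_right min_def drop_take intro!: sum.cong)
    also have "\<dots> = (\<Sum>j=0..?n. \<Sum>i=0..?n - j. ?c j i (?n - j - i))"
      by (rule fps_mult_assoc_lemma)
    also have "\<dots> = (\<Sum>j=0..?n. f (take j w) *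
        (\<Sum>i=0..length (drop j w). g (take i (drop j w)) * h (drop i (drop j w))))"
      by (intro sum.cong refl) (auto simp: sum_distrib_left mult.assoc add.commute intro!: sum.cong)
    finally show "(\<Sum>j=0..?n. (\<Sum>i=0..length (take j w). f (take i (take j w)) * g (drop i (take j w))) * h (drop j w))
        = (\<Sum>j=0..?n. f (take j w) *
        (\<Sum>i=0..length (drop j w). g (take i (drop j w)) * h (drop i (drop j w))))" .
  qed
  show "1 * f = f"
  proof (transfer, rule ext)
    fix f :: "'a list \<Rightarrow> 'b" and w :: "'a list"
    have "(\<Sum>i=0..length w. (if take i w = [] then 1 else 0) * f (drop i w))
        = (\<Sum>i=0..length w. if i = 0 then f w else 0)"
      by (intro sum.cong refl) auto
    then show "(\<Sum>i=0..length w. (if take i w = [] then 1 else 0) * f (drop i w)) = f w"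
      by simp
  qed
  show "f * 1 = f"
  proof (transfer, rule ext)
    fix f :: "'a list \<Rightarrow> 'b" and w :: "'a list"
    have "(\<Sum>i=0..length w. f (take i w) * (if drop i w = [] then 1 else 0))
        = (\<Sum>i=0..length w. if i = length w then f w else 0)"
      by (intro sum.cong refl) auto
    then show "(\<Sum>i=0..length w. f (take i w) * (if drop i w = [] then 1 else 0)) = f w"
      by simp
  qed
  show "f + g + h = f + (g + h)" by transfer (simp add: add.assoc)
  show "f + g = g + f" by transfer (simp add: add.commute)
  show "0 + f = f" by transfer simp
  show "- f + f = 0" by transfer simp
  show "f - g = f + - g" by transfer simp
  show "(f + g) * h = f * h + g * h"
    by transfer (simp add: distrib_right sum.distrib)
  show "f * (g + h) = f * g + f * h"
    by transfer (simp add: distrib_left sum.distrib)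
  show "(0 :: ('a, 'b) ncfps) \<noteq> 1"
    by transfer (metis zero_neq_one)
qed

end

lift_definition nc_scale :: "'a::ring_1 \<Rightarrow> ('v, 'a) ncfps \<Rightarrow> ('v, 'a) ncfps"
  is "\<lambda>c f w. c * f w" .

lift_definition nc_var :: "'v \<Rightarrow> ('v, 'a::ring_1) ncfps"
  is "\<lambda>i w. if w = [i] then 1 else 0" .

lift_definition nc_map :: "('a \<Rightarrow> 'b) \<Rightarrow> ('v, 'a) ncfps \<Rightarrow> ('v, 'b) ncfps"
  is "\<lambda>\<phi> f w. \<phi> (f w)" .

text \<open>The inclusion of \<open>k\<langle>\<langle>z\<rangle>\<rangle>\<close> into \<open>k[[t]]\<langle>\<langle>z\<rangle>\<rangle>\<close>.\<close>

definition nc_embed :: "('v, 'k::idom) ncfps \<Rightarrow> ('v, 'k fps) ncfps" where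
  "nc_embed = nc_map fps_const"

definition nc_dt :: "('v, 'k::idom fps) ncfps \<Rightarrow> ('v, 'k fps) ncfps" where
  "nc_dt = nc_map fps_deriv"

text \<open>The zero series has order \<^term>\<open>\<infinity> :: enat\<close>.\<close>

definition nc_order :: "('v, 'a::ring_1) ncfps \<Rightarrow> enat" where
  "nc_order f = (INF w\<in>{w. nc_coeff f w \<noteq> 0}. enat (length w))"

definition nc_vec_order :: "('v \<Rightarrow> ('v, 'a::ring_1) ncfps) \<Rightarrow> enat" where
  "nc_vec_order U = (INF i. nc_order (U i))"

text \<open>
  \<open>nc_subst F u\<close> is \<open>u(F) = \<Sum>\<^sub>v u\<^sub>v F\<^sup>v\<close>, the sum ranging over all words \<open>v = i\<^sub>1\<dots>i\<^sub>r\<close>, with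
  \<open>F\<^sup>v = F\<^bsub>i\<^sub>1\<^esub> \<cdots> F\<^bsub>i\<^sub>r\<^esub>\<close>. If every component of \<open>F\<close> has zero constant term and there are finitely
  many variables, then only words \<open>v\<close> of length at most \<open>length w\<close> contribute to the coefficient
  at \<open>w\<close>, so the sum is finite. (\<^const>\<open>Sum_any\<close> is \<open>0\<close> on infinite support, so substitution is
  meaningful only for such \<open>F\<close>.)
\<close>

definition nc_subst ::
  "('v \<Rightarrow> ('v, 'a::comm_ring_1) ncfps) \<Rightarrow> ('v, 'a) ncfps \<Rightarrow> ('v, 'a) ncfps" where
  "nc_subst F u =
     Abs_ncfps (\<lambda>w. Sum_any (\<lambda>v. nc_coeff u v * nc_coeff (prod_list (map F v)) w))"

text \<open>
  \<open>F(G(z)) = z = G(F(z))\<close>. When \<open>F\<close> has zero constant terms, so does \<open>G\<close>, as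
  the constant term of \<open>G\<^sub>i(F)\<close> is that of \<open>G\<^sub>i\<close>; hence both substitutions are meaningful.
\<close>

definition nc_inverse_map ::
  "('v \<Rightarrow> ('v, 'a::comm_ring_1) ncfps) \<Rightarrow> ('v \<Rightarrow> ('v, 'a) ncfps) \<Rightarrow> bool" where
  "nc_inverse_map F G \<longleftrightarrow>
     (\<forall>i. nc_subst G (F i) = nc_var i) \<and> (\<forall>i. nc_subst F (G i) = nc_var i)"

definition nc_derivation :: "(('v, 'a::comm_ring_1) ncfps \<Rightarrow> ('v, 'a) ncfps) \<Rightarrow> bool" where
  "nc_derivation D \<longleftrightarrow>
     (\<forall>f g. D (f + g) = D f + D g) \<and>
     (\<forall>c f. D (nc_scale c f) = nc_scale c (D f)) \<and>
     (\<forall>f g. D (f * g) = D f * g + f * D g)"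

text \<open>
  \<open>[u \<partial>/\<partial>z]\<close>. For finitely many variables it exists for every \<open>u\<close>; it is unique since a derivation
  lowers the order of a series by at most one.
\<close>

definition nc_vec_deriv ::
  "('v \<Rightarrow> ('v, 'a::comm_ring_1) ncfps) \<Rightarrow> ('v, 'a) ncfps \<Rightarrow> ('v, 'a) ncfps" where
  "nc_vec_deriv u = (THE D. nc_derivation D \<and> (\<forall>i. D (nc_var i) = u i))"

end

theory Submission
  imports Defs
begin

text \<open>
  Every series is \<open>f = c + \<Sum>\<^sub>i z\<^sub>i f\<^sub>i\<close>. Hence an additive map \<open>E\<close> that vanishes on constants and
  satisfies \<open>E(z\<^sub>i f) = P\<^sub>i E(f)\<close>, with \<open>P\<^sub>i\<close> of zero constant term, is zero, by induction on the
  length of words. Multiplicativity and composition of substitutions, existence and uniqueness of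
  \<open>[u \<partial>/\<partial>z]\<close>, the chain rule, and the intertwining relation \<open>m(v(G)) = (h v)(G)\<close> are all instances,
  \<open>E\<close> being the difference of the two sides. The intertwining relation needs \<open>m G\<^sub>i = \<partial>M\<^sub>i/\<partial>t\<close>, which is
  the chain rule \<open>\<partial>(v(F))/\<partial>t = (\<partial>v/\<partial>t)(F) - (m v)(F)\<close> applied to \<open>v = G\<^sub>i\<close>, as \<open>G\<^sub>i(F) = z\<^sub>i\<close>.
\<close>

section \<open>Coefficients, left quotients and the vanishing principle\<close>

lemmas nc_coeff_simps =
  zero_ncfps.rep_eq one_ncfps.rep_eq plus_ncfps.rep_eq minus_ncfps.rep_eq uminus_ncfps.rep_eq
  nc_scale.rep_eq nc_var.rep_eq nc_map.rep_eq

lemma nc_coeff_sum: "nc_coeff (sum f A) w = (\<Sum>i\<in>A. nc_coeff (f i) w)"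
  by (induction A rule: infinite_finite_induct) (simp_all add: nc_coeff_simps)

lemma nc_coeff_mult_Nil: "nc_coeff (f * g) [] = nc_coeff f [] * nc_coeff g []"
  by (simp add: times_ncfps.rep_eq)

lemma nc_coeff_var_mult:
  "nc_coeff (nc_var i * f) w = (case w of [] \<Rightarrow> 0 | j # v \<Rightarrow> if j = i then nc_coeff f v else 0)"
proof (cases w)
  case Nil
  then show ?thesis by (simp add: nc_coeff_mult_Nil nc_var.rep_eq)
next
  case (Cons j v)
  have "nc_coeff (nc_var i * f) w
      = (\<Sum>k=0..length w. if k = 1 then (if j = i then nc_coeff f v else 0) else 0)"
    unfolding times_ncfps.rep_eq nc_var.rep_eq
  proof (intro sum.cong refl)
    fix k assume "k \<in> {0..length w}"
    moreover have "take k w = [i] \<longleftrightarrow> k = 1 \<and> j = i"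
      using Cons calculation by (cases k) (auto simp: take_Suc)
    ultimately show "(if take k w = [i] then 1 else 0) * nc_coeff f (drop k w)
        = (if k = 1 then (if j = i then nc_coeff f v else 0) else 0)"
      using Cons by auto
  qed
  then show ?thesis using Cons by (simp add: Suc_le_eq)
qed

lemma nc_scale_mult_left: "nc_scale c f * g = nc_scale c (f * g)"
  by (rule ncfps_eqI) (simp add: times_ncfps.rep_eq nc_coeff_simps sum_distrib_left mult.assoc)

lemma nc_scale_mult_right:
  fixes c :: "'a::comm_ring_1"
  shows "f * nc_scale c g = nc_scale c (f * g)"
  by (rule ncfps_eqI)
    (simp add: times_ncfps.rep_eq nc_coeff_simps sum_distrib_left mult.left_commute)

lemma nc_scale_zero: "nc_scale c 0 = 0"
  by (rule ncfps_eqI) (simp add: nc_coeff_simps)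

text \<open>The component \<open>f_i\<close> in the splitting of a series by first letters;
  stripping letters from the front matches recursion on \<open>#\<close>.\<close>

lift_definition nc_lquot :: "'v \<Rightarrow> ('v, 'a) ncfps \<Rightarrow> ('v, 'a) ncfps"
  is "\<lambda>i f w. f (i # w)" .

lemma nc_lquot_add: "nc_lquot i (f + g) = nc_lquot i f + nc_lquot i g"
  by (rule ncfps_eqI) (simp add: nc_coeff_simps nc_lquot.rep_eq)

lemma nc_lquot_scale: "nc_lquot i (nc_scale c f) = nc_scale c (nc_lquot i f)"
  by (rule ncfps_eqI) (simp add: nc_coeff_simps nc_lquot.rep_eq)

lemma nc_lquot_one: "nc_lquot i 1 = 0"
  by (rule ncfps_eqI) (simp add: nc_coeff_simps nc_lquot.rep_eq)

lemma nc_lquot_var_mult: "nc_lquot j (nc_var i * f) = (if j = i then f else 0)"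
  by (rule ncfps_eqI) (simp add: nc_lquot.rep_eq nc_coeff_var_mult nc_coeff_simps)

lemma ncfps_decompose:
  fixes f :: "('v::finite, 'a::ring_1) ncfps"
  shows "f = nc_scale (nc_coeff f []) 1 + (\<Sum>i\<in>UNIV. nc_var i * nc_lquot i f)"
proof (rule ncfps_eqI)
  fix w
  show "nc_coeff f w
      = nc_coeff (nc_scale (nc_coeff f []) 1 + (\<Sum>i\<in>UNIV. nc_var i * nc_lquot i f)) w"
    by (cases w) (simp_all add: nc_coeff_simps nc_coeff_sum nc_coeff_var_mult nc_lquot.rep_eq)
qed

text \<open>At \<open>w\<close>, the product \<open>P i * E (nc_lquot i f)\<close> involves
  \<open>E\<close> only at proper suffixes of \<open>w\<close>, because \<open>P i\<close> has no
  constant term. The finite splitting by first letters takes the place of a continuity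
  argument.\<close>

lemma additive_ncfps_eq_zero:
  fixes E :: "('v::finite, 'a::ring_1) ncfps \<Rightarrow> ('v, 'a) ncfps"
  assumes add: "\<And>f g. E (f + g) = E f + E g"
    and const: "\<And>c. E (nc_scale c 1) = 0"
    and var: "\<And>i f. E (nc_var i * f) = P i * E f"
    and P: "\<And>i. nc_coeff (P i) [] = 0"
  shows "E f = 0"
proof -
  have E0: "E 0 = 0"
    using add[of 0 0] by simp
  have E_sum: "E (sum g A) = (\<Sum>i\<in>A. E (g i))" for g and A :: "'v set"
    by (induction A rule: infinite_finite_induct) (simp_all add: E0 add)
  have E_eq: "E f = (\<Sum>i\<in>UNIV. P i * E (nc_lquot i f))" for f
    by (subst ncfps_decompose) (simp add: add const E_sum var)
  have "nc_coeff (E f) w = 0" for w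
  proof (induction "length w" arbitrary: w f rule: less_induct)
    case less
    have "nc_coeff (P i * E (nc_lquot i f)) w = 0" for i
      unfolding times_ncfps.rep_eq
    proof (intro sum.neutral ballI)
      fix k assume "k \<in> {0..length w}"
      then show "nc_coeff (P i) (take k w) * nc_coeff (E (nc_lquot i f)) (drop k w) = 0"
        using P[of i] less[of "drop k w"] by (cases "k = 0") auto
    qed
    then show ?case
      by (subst E_eq) (simp add: nc_coeff_sum)
  qed
  then show ?thesis
    by (intro ncfps_eqI) (simp add: zero_ncfps.rep_eq)
qed

section \<open>Substitution\<close>

text \<open>Each factor has order at least 1, so the product has order at least
  \<open>length v\<close>.\<close>

lemma nc_coeff_monomial_eq_zero:
  assumes "\<And>i. nc_coeff (F i) [] = 0" and "length w < length v"
  shows "nc_coeff (prod_list (map F v)) w = 0"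
  using assms(2)
proof (induction v arbitrary: w)
  case (Cons i v)
  have "nc_coeff (F i * prod_list (map F v)) w = 0"
    unfolding times_ncfps.rep_eq
  proof (intro sum.neutral ballI)
    fix k assume "k \<in> {0..length w}"
    then show "nc_coeff (F i) (take k w) * nc_coeff (prod_list (map F v)) (drop k w) = 0"
      using assms(1)[of i] Cons by (cases "k = 0") auto
  qed
  then show ?case by simp
qed simp

lemma finite_words_length_le: "finite {v :: 'v::finite list. length v \<le> N}"
  using finite_lists_length_le[of "UNIV :: 'v set" N] by simp

text \<open>The bound \<open>N\<close> is left free so that coefficients at different words, such as
  all suffixes of one word, can be summed over the same index set.\<close>

lemma nc_coeff_subst:
  fixes F :: "'v::finite \<Rightarrow> ('v, 'a::comm_ring_1) ncfps"
  assumes "\<And>i. nc_coeff (F i) [] = 0" and "length w \<le> N"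
  shows "nc_coeff (nc_subst F u) w
    = (\<Sum>v | length v \<le> N. nc_coeff u v * nc_coeff (prod_list (map F v)) w)"
proof -
  have "v \<in> {v. length v \<le> N}"
    if "nc_coeff u v * nc_coeff (prod_list (map F v)) w \<noteq> 0" for v
    using that nc_coeff_monomial_eq_zero[OF assms(1), of w v] assms(2)
    by (cases "length w < length v") auto
  then have "Sum_any (\<lambda>v. nc_coeff u v * nc_coeff (prod_list (map F v)) w)
      = (\<Sum>v | length v \<le> N. nc_coeff u v * nc_coeff (prod_list (map F v)) w)"
    by (intro Sum_any.expand_superset finite_words_length_le) blast
  then show ?thesis
    by (simp add: nc_subst_def Abs_ncfps_inverse)
qed

lemma nc_subst_one:
  fixes F :: "'v \<Rightarrow> ('v, 'a::comm_ring_1) ncfps"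
  shows "nc_subst F 1 = 1"
proof (rule ncfps_eqI)
  fix w
  have "Sum_any (\<lambda>v. nc_coeff 1 v * nc_coeff (prod_list (map F v)) w)
      = Sum_any (\<lambda>v :: 'v list. if v = [] then nc_coeff 1 w else 0)"
    by (rule Sum_any.cong) (simp add: one_ncfps.rep_eq)
  then show "nc_coeff (nc_subst F 1) w = nc_coeff 1 w"
    by (simp add: nc_subst_def Abs_ncfps_inverse)
qed

context
  fixes F :: "'v::finite \<Rightarrow> ('v, 'a::comm_ring_1) ncfps"
  assumes F0: "\<And>i. nc_coeff (F i) [] = 0"
begin

lemma nc_coeff_subst_Nil: "nc_coeff (nc_subst F u) [] = nc_coeff u []"
  by (simp add: nc_coeff_subst[OF F0, where N = 0] one_ncfps.rep_eq)

lemma nc_subst_add: "nc_subst F (f + g) = nc_subst F f + nc_subst F g"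
  by (rule ncfps_eqI)
    (simp add: nc_coeff_subst[OF F0 order_refl] nc_coeff_simps distrib_right sum.distrib)

lemma nc_subst_scale: "nc_subst F (nc_scale c f) = nc_scale c (nc_subst F f)"
  by (rule ncfps_eqI)
    (simp add: nc_coeff_subst[OF F0 order_refl] nc_coeff_simps sum_distrib_left mult.assoc)

lemma nc_subst_zero: "nc_subst F 0 = 0"
  using nc_subst_add[of 0 0] by simp

lemma nc_subst_uminus: "nc_subst F (- f) = - nc_subst F f"
  using nc_subst_add[of f "- f"] nc_subst_zero by (simp add: eq_neg_iff_add_eq_0 add.commute)

text \<open>Supplies the hypothesis \<open>var\<close> of \<open>additive_ncfps_eq_zero\<close> with
  \<open>P = F\<close>. Only words starting with \<open>i\<close> contribute, and removing that
  letter leaves \<open>f\<close>.\<close>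

lemma nc_subst_var_mult: "nc_subst F (nc_var i * f) = F i * nc_subst F f"
proof (rule ncfps_eqI)
  fix w :: "'v list"
  let ?n = "length w"
  \<comment> \<open>The bound is raised to \<open>Suc ?n\<close> so that every \<open>i # v\<close>
    with \<open>length v \<le> ?n\<close> is included.\<close>
  have "nc_coeff (nc_subst F (nc_var i * f)) w
      = (\<Sum>v | length v \<le> Suc ?n. nc_coeff (nc_var i * f) v * nc_coeff (prod_list (map F v)) w)"
    by (rule nc_coeff_subst[OF F0]) simp
  also have "\<dots> = (\<Sum>v\<in>(#) i ` {v. length v \<le> ?n}. nc_coeff (nc_var i * f) v * nc_coeff (prod_list (map F v)) w)"
    by (rule sum.mono_neutral_right)
      (auto simp: finite_words_length_le nc_coeff_var_mult image_iff split: list.splits if_splits)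
  also have "\<dots> = (\<Sum>v | length v \<le> ?n. nc_coeff f v * nc_coeff (F i * prod_list (map F v)) w)"
    by (subst sum.reindex) (simp_all add: nc_coeff_var_mult)
  also have "\<dots> = (\<Sum>k=0..?n. nc_coeff (F i) (take k w)
      * (\<Sum>v | length v \<le> ?n. nc_coeff f v * nc_coeff (prod_list (map F v)) (drop k w)))"
    unfolding times_ncfps.rep_eq sum_distrib_left
    by (subst sum.swap) (simp add: mult.left_commute)
  also have "\<dots> = nc_coeff (F i * nc_subst F f) w"
    by (simp add: times_ncfps.rep_eq nc_coeff_subst[OF F0, where N = ?n])
  finally show "nc_coeff (nc_subst F (nc_var i * f)) w = nc_coeff (F i * nc_subst F f) w" .
qed

lemma nc_subst_var: "nc_subst F (nc_var i) = F i"
  using nc_subst_var_mult[of i 1] by (simp add: nc_subst_one)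

text \<open>With \<open>g\<close> fixed, both sides satisfy the same recursion in \<open>f\<close>
  and agree on constants.\<close>

lemma nc_subst_mult: "nc_subst F (f * g) = nc_subst F f * nc_subst F g"
proof -
  have "nc_subst F (f * g) - nc_subst F f * nc_subst F g = 0"
    by (rule additive_ncfps_eq_zero[where P = F and f = f])
      (simp_all add: F0 nc_subst_add nc_subst_scale nc_subst_one nc_subst_var_mult
        nc_scale_mult_left algebra_simps)
  then show ?thesis by simp
qed

end

text \<open>On the left the factor \<open>nc_subst F (G i)\<close> splits off because substituting
  \<open>F\<close> is multiplicative.\<close>

lemma nc_subst_subst:
  fixes F G :: "'v::finite \<Rightarrow> ('v, 'a::comm_ring_1) ncfps"
  assumes F0: "\<And>i. nc_coeff (F i) [] = 0" and G0: "\<And>i. nc_coeff (G i) [] = 0"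
  shows "nc_subst F (nc_subst G f) = nc_subst (\<lambda>i. nc_subst F (G i)) f"
proof -
  have FG0: "nc_coeff (nc_subst F (G i)) [] = 0" for i
    by (simp add: nc_coeff_subst_Nil[OF F0] G0)
  note rules = nc_subst_add nc_subst_scale nc_subst_var_mult
  have "nc_subst F (nc_subst G f) - nc_subst (\<lambda>i. nc_subst F (G i)) f = 0"
    by (rule additive_ncfps_eq_zero[where P = "\<lambda>i. nc_subst F (G i)" and f = f])
      (simp_all add: FG0 rules[OF F0] rules[OF G0] rules[OF FG0] nc_subst_one
        nc_subst_mult[OF F0] algebra_simps)
  then show ?thesis by simp
qed

lemma nc_subst_id:
  fixes f :: "('v::finite, 'a::comm_ring_1) ncfps"
  shows "nc_subst nc_var f = f"
proof -
  have var0: "nc_coeff (nc_var i :: ('v, 'a) ncfps) [] = 0" for i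
    by (simp add: nc_var.rep_eq)
  have "nc_subst nc_var f - f = 0"
    by (rule additive_ncfps_eq_zero[where P = nc_var and f = f])
      (simp_all add: var0 nc_subst_add[OF var0] nc_subst_scale[OF var0] nc_subst_one
        nc_subst_var_mult[OF var0] algebra_simps)
  then show ?thesis by simp
qed

section \<open>Derivations\<close>

lemma nc_derivation_add: "nc_derivation D \<Longrightarrow> D (f + g) = D f + D g"
  and nc_derivation_scale: "nc_derivation D \<Longrightarrow> D (nc_scale c f) = nc_scale c (D f)"
  and nc_derivation_mult: "nc_derivation D \<Longrightarrow> D (f * g) = D f * g + f * D g"
  by (simp_all add: nc_derivation_def)

lemma nc_derivation_one: "nc_derivation D \<Longrightarrow> D 1 = 0"
  using nc_derivation_mult[of D 1 1] by simp

lemma nc_derivation_uminus: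
  assumes "nc_derivation D"
  shows "nc_derivation (\<lambda>f. - D f)"
proof -
  have "- nc_scale c g = nc_scale c (- g)" for c and g :: "('a, 'b) ncfps"
    by (rule ncfps_eqI) (simp add: nc_coeff_simps)
  then show ?thesis
    using assms by (simp add: nc_derivation_def)
qed

text \<open>In \<open>D - D'\<close> the Leibniz terms containing the values at
  \<open>nc_var i\<close> cancel, which leaves multiplication by \<open>nc_var i\<close>.\<close>

lemma nc_derivation_unique:
  fixes D D' :: "('v::finite, 'a::comm_ring_1) ncfps \<Rightarrow> ('v, 'a) ncfps"
  assumes D: "nc_derivation D" and D': "nc_derivation D'"
    and eq: "\<And>i. D (nc_var i) = D' (nc_var i)"
  shows "D = D'"
proof
  fix f
  note rules = nc_derivation_add nc_derivation_scale nc_derivation_mult nc_derivation_one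
  have "D f - D' f = 0"
    by (rule additive_ncfps_eq_zero[where P = nc_var and f = f])
      (simp_all add: rules[OF D] rules[OF D'] eq nc_scale_zero nc_var.rep_eq algebra_simps)
  then show "D f = D' f" by simp
qed

text \<open>
  Recursion on words solves the equation \<open>D f = \<Sum>\<^sub>i (u\<^sub>i f\<^sub>i + z\<^sub>i D f\<^sub>i)\<close>, where \<open>f\<^sub>i\<close> is the left
  quotient of \<open>f\<close> by \<open>z\<^sub>i\<close>: the coefficient of \<open>z\<^sub>i D f\<^sub>i\<close> at \<open>i # w\<close> is that of \<open>D f\<^sub>i\<close> at \<open>w\<close>.
\<close>

primrec vec_deriv_coeff ::
  "('v::finite \<Rightarrow> ('v, 'a::comm_ring_1) ncfps) \<Rightarrow> 'v list \<Rightarrow> ('v, 'a) ncfps \<Rightarrow> 'a" where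
  "vec_deriv_coeff u [] f = nc_coeff (\<Sum>i\<in>UNIV. u i * nc_lquot i f) []"
| "vec_deriv_coeff u (j # w) f =
     nc_coeff (\<Sum>i\<in>UNIV. u i * nc_lquot i f) (j # w) + vec_deriv_coeff u w (nc_lquot j f)"

text \<open>The recursion builds in the Leibniz rule only for a left factor \<open>nc_var i\<close>;
  the vanishing principle in the left factor extends it to all products.\<close>

lemma nc_derivation_exists:
  fixes u :: "'v::finite \<Rightarrow> ('v, 'a::comm_ring_1) ncfps"
  shows "\<exists>D. nc_derivation D \<and> (\<forall>i. D (nc_var i) = u i)"
proof -
  define D where "D f = Abs_ncfps (\<lambda>w. vec_deriv_coeff u w f)" for f
  have D_coeff: "nc_coeff (D f) w = vec_deriv_coeff u w f" for f w
    by (simp add: D_def Abs_ncfps_inverse)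
  have coeff_add: "vec_deriv_coeff u w (f + g) = vec_deriv_coeff u w f + vec_deriv_coeff u w g"
    for f g w
    by (induction w arbitrary: f g)
      (simp_all add: nc_lquot_add distrib_left sum.distrib nc_coeff_simps algebra_simps)
  have D_add: "D (f + g) = D f + D g" for f g
    by (rule ncfps_eqI) (simp add: D_coeff nc_coeff_simps coeff_add)
  have coeff_scale: "vec_deriv_coeff u w (nc_scale c f) = c * vec_deriv_coeff u w f" for c f w
    by (induction w arbitrary: f)
      (simp_all add: nc_lquot_scale nc_scale_mult_right nc_coeff_sum nc_coeff_simps
        sum_distrib_left algebra_simps)
  have D_scale: "D (nc_scale c f) = nc_scale c (D f)" for c f
    by (rule ncfps_eqI) (simp add: D_coeff nc_coeff_simps coeff_scale)
  have D_zero: "D 0 = 0"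
    using D_add[of 0 0] by simp
  have coeff_zero: "vec_deriv_coeff u w 0 = 0" for w
    using D_coeff[of 0 w] by (simp add: D_zero nc_coeff_simps)
  have D_one: "D 1 = 0"
  proof (rule ncfps_eqI)
    fix w
    show "nc_coeff (D 1) w = nc_coeff 0 w"
      by (cases w) (simp_all add: D_coeff nc_lquot_one nc_coeff_sum nc_coeff_simps coeff_zero)
  qed
  have D_var_mult: "D (nc_var i * f) = u i * f + nc_var i * D f" for i f
  proof (rule ncfps_eqI)
    fix w
    have "(\<Sum>j\<in>UNIV. u j * nc_lquot j (nc_var i * f)) = (\<Sum>j\<in>UNIV. if j = i then u i * f else 0)"
      by (rule sum.cong) (auto simp: nc_lquot_var_mult)
    then have "(\<Sum>j\<in>UNIV. u j * nc_lquot j (nc_var i * f)) = u i * f"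
      by simp
    then show "nc_coeff (D (nc_var i * f)) w = nc_coeff (u i * f + nc_var i * D f) w"
      by (cases w)
        (simp_all add: D_coeff nc_coeff_simps nc_coeff_var_mult nc_lquot_var_mult coeff_zero)
  qed
  have D_mult: "D (f * g) = D f * g + f * D g" for f g
  proof -
    have "D (f * g) - (D f * g + f * D g) = 0"
      by (rule additive_ncfps_eq_zero[where P = nc_var and f = f])
        (simp_all add: D_add D_scale D_one D_var_mult nc_scale_zero nc_scale_mult_left
          nc_var.rep_eq algebra_simps)
    then show ?thesis by simp
  qed
  have "D (nc_var i) = u i" for i
    using D_var_mult[of i 1] by (simp add: D_one)
  then show ?thesis
    unfolding nc_derivation_def using D_add D_scale D_mult by blast
qed

lemma
  fixes u :: "'v::finite \<Rightarrow> ('v, 'a::comm_ring_1) ncfps"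
  shows nc_derivation_vec_deriv: "nc_derivation (nc_vec_deriv u)"
    and nc_vec_deriv_var: "nc_vec_deriv u (nc_var i) = u i"
proof -
  have "\<exists>!D. nc_derivation D \<and> (\<forall>i. D (nc_var i) = u i)"
    using nc_derivation_exists[of u] by (auto intro: nc_derivation_unique)
  from theI'[OF this] show "nc_derivation (nc_vec_deriv u)" "nc_vec_deriv u (nc_var i) = u i"
    by (simp_all add: nc_vec_deriv_def)
qed

section \<open>The derivative in \<open>t\<close> and the chain rule\<close>

lemma nc_coeff_dt: "nc_coeff (nc_dt f) w = fps_deriv (nc_coeff f w)"
  by (simp add: nc_dt_def nc_map.rep_eq)

lemma nc_dt_add: "nc_dt (f + g) = nc_dt f + nc_dt g"
  by (rule ncfps_eqI) (simp add: nc_coeff_dt nc_coeff_simps)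

lemma nc_dt_diff: "nc_dt (f - g) = nc_dt f - nc_dt g"
  by (rule ncfps_eqI) (simp add: nc_coeff_dt nc_coeff_simps)

lemma nc_dt_mult: "nc_dt (f * g) = nc_dt f * g + f * nc_dt g"
  by (rule ncfps_eqI)
    (simp add: nc_coeff_dt nc_coeff_simps times_ncfps.rep_eq fps_deriv_sum sum.distrib add.commute)

lemma nc_dt_var: "nc_dt (nc_var i) = 0"
  by (rule ncfps_eqI) (simp add: nc_coeff_dt nc_coeff_simps)

lemma nc_dt_scale_one: "nc_dt (nc_scale c 1) = nc_scale (fps_deriv c) 1"
  by (rule ncfps_eqI) (simp add: nc_coeff_dt nc_coeff_simps)

lemma nc_dt_embed: "nc_dt (nc_embed u) = 0"
  by (rule ncfps_eqI) (simp add: nc_coeff_dt nc_embed_def nc_coeff_simps)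

text \<open>The first summand accounts for the \<open>t\<close>-dependence of the coefficients of
  \<open>f\<close>, the second for that of \<open>F\<close>. By the Leibniz rules and
  \<open>DF\<close>, replacing \<open>f\<close> by \<open>nc_var i * f\<close> multiplies the
  difference of the two sides by \<open>F i\<close>.\<close>

lemma nc_dt_subst:
  fixes F :: "'v::finite \<Rightarrow> ('v, 'k::idom fps) ncfps"
  assumes F0: "\<And>i. nc_coeff (F i) [] = 0"
    and D: "nc_derivation D"
    and DF: "\<And>i. nc_subst F (D (nc_var i)) = nc_dt (F i)"
  shows "nc_dt (nc_subst F f) = nc_subst F (nc_dt f) + nc_subst F (D f)"
proof -
  note S = nc_subst_add[OF F0] nc_subst_scale[OF F0] nc_subst_one nc_subst_mult[OF F0]
    nc_subst_zero[OF F0] nc_subst_var[OF F0]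
  note D = nc_derivation_add[OF D] nc_derivation_scale[OF D] nc_derivation_mult[OF D]
    nc_derivation_one[OF D]
  have "nc_dt (nc_subst F f) - (nc_subst F (nc_dt f) + nc_subst F (D f)) = 0"
    by (rule additive_ncfps_eq_zero[where P = F and f = f])
      (simp_all add: S D DF F0 nc_dt_add nc_dt_mult nc_dt_var nc_dt_scale_one nc_scale_zero
        algebra_simps)
  then show ?thesis by simp
qed

theorem proposition3p3:
  fixes H F G M :: "'n::finite \<Rightarrow> ('n, 'k::idom fps) ncfps"
    and h m :: "('n, 'k fps) ncfps \<Rightarrow> ('n, 'k fps) ncfps"
    and u :: "('n, 'k) ncfps"
  assumes "nc_vec_order H \<ge> 2"
    and "F = (\<lambda>i. nc_var i - H i)"
    and "nc_inverse_map F G"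
    and "M = (\<lambda>i. G i - nc_var i)"
    and "h = nc_vec_deriv (\<lambda>i. nc_subst F (nc_dt (M i)))"
    and "m = nc_vec_deriv (\<lambda>i. nc_subst G (nc_dt (H i)))"
  shows "nc_dt (nc_subst F (nc_embed u)) = - nc_subst F (m (nc_embed u))
       \<and> - nc_subst F (m (nc_embed u)) = - h (nc_subst F (nc_embed u))
       \<and> nc_dt (nc_subst G (nc_embed u)) = nc_subst G (h (nc_embed u))
       \<and> nc_subst G (h (nc_embed u)) = m (nc_subst G (nc_embed u))"
proof -
  have H0: "nc_coeff (H i) [] = 0" for i
  proof (rule ccontr)
    assume "nc_coeff (H i) [] \<noteq> 0"
    then have "nc_order (H i) \<le> enat (length ([] :: 'n list))"
      unfolding nc_order_def by (intro INF_lower) simp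
    moreover have "nc_vec_order H \<le> nc_order (H i)"
      unfolding nc_vec_order_def by (rule INF_lower) simp
    ultimately have "(2::enat) \<le> 0"
      using assms(1) by (metis order_trans list.size(3) zero_enat_def)
    then show False by simp
  qed
  have F0: "nc_coeff (F i) [] = 0" for i
    by (simp add: assms(2) nc_coeff_simps H0)
  have GF: "nc_subst G (F i) = nc_var i" and FG: "nc_subst F (G i) = nc_var i" for i
    using assms(3) by (simp_all add: nc_inverse_map_def)
  \<comment> \<open>Substituting \<open>F\<close> preserves constant terms and sends
    \<open>G i\<close> to \<open>nc_var i\<close>.\<close>
  have G0: "nc_coeff (G i) [] = 0" for i
    by (simp flip: nc_coeff_subst_Nil[of F, OF F0] add: FG nc_var.rep_eq)
  have FG_subst: "nc_subst F (nc_subst G f) = f" and GF_subst: "nc_subst G (nc_subst F f) = f" for f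
    by (simp_all add: nc_subst_subst F0 G0 FG GF nc_subst_id)
  have h: "nc_derivation h" and h_var: "h (nc_var i) = nc_subst F (nc_dt (G i))" for i
    by (simp_all add: assms(4,5) nc_derivation_vec_deriv nc_vec_deriv_var nc_dt_diff nc_dt_var)
  have m: "nc_derivation m" and m_var: "m (nc_var i) = nc_subst G (nc_dt (H i))" for i
    by (simp_all add: assms(6) nc_derivation_vec_deriv nc_vec_deriv_var)
  have dt_F: "nc_dt (nc_subst F f) = nc_subst F (nc_dt f) - nc_subst F (m f)" for f
  proof -
    have dt_F_eq: "nc_dt (F i) = - nc_dt (H i)" for i
      by (simp add: assms(2) nc_dt_diff nc_dt_var)
    \<comment> \<open>The chain rule with \<open>D = - m\<close>: \<open>F\<close> undoes the
      \<open>G\<close> inside \<open>m_var\<close>, leaving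
      \<open>- nc_dt (H i) = nc_dt (F i)\<close>.\<close>
    have "nc_dt (nc_subst F f) = nc_subst F (nc_dt f) + nc_subst F (- m f)"
      by (rule nc_dt_subst[of F, OF F0 nc_derivation_uminus[OF m]])
        (simp add: nc_subst_uminus[OF F0] m_var FG_subst dt_F_eq)
    then show ?thesis by (simp add: nc_subst_uminus[OF F0])
  qed
  \<comment> \<open>Here \<open>D = h\<close>, as \<open>G\<close> undoes the \<open>F\<close>
    inside \<open>h_var\<close>.\<close>
  have dt_G: "nc_dt (nc_subst G f) = nc_subst G (nc_dt f) + nc_subst G (h f)" for f
    by (rule nc_dt_subst[of G, OF G0 h]) (simp add: h_var GF_subst)
  have m_G: "m (G i) = nc_dt (G i)" for i
  proof -
    have "nc_subst F (m (G i)) = nc_subst F (nc_dt (G i))"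
      using dt_F[of "G i"] by (simp add: FG nc_dt_var)
    then show ?thesis by (metis GF_subst)
  qed
  note S = nc_subst_add[OF G0] nc_subst_scale[OF G0] nc_subst_one nc_subst_mult[OF G0]
    nc_subst_zero[OF G0] nc_subst_var[OF G0]
  note rules = nc_derivation_add nc_derivation_scale nc_derivation_mult nc_derivation_one
  have m_G_subst: "m (nc_subst G f) = nc_subst G (h f)" for f
  proof -
    \<comment> \<open>For \<open>nc_var i * f\<close> the terms
      \<open>m (G i) * nc_subst G f\<close> and
      \<open>nc_subst G (h (nc_var i)) * nc_subst G f\<close> cancel, both first factors being
      \<open>nc_dt (G i)\<close>.\<close>
    have "m (nc_subst G f) - nc_subst G (h f) = 0"
      by (rule additive_ncfps_eq_zero[where P = G and f = f])
        (simp_all add: S rules[OF m] rules[OF h] h_var GF_subst m_G G0 nc_scale_zero algebra_simps)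
    then show ?thesis by simp
  qed
  \<comment> \<open>Conjugating the intertwining relation by \<open>F\<close> gives the second
    equality.\<close>
  have "nc_subst F (m f) = h (nc_subst F f)" for f
    using m_G_subst[of "nc_subst F f"] by (simp add: GF_subst FG_subst)
  \<comment> \<open>The coefficients of \<open>nc_embed u\<close> are constant in \<open>t\<close>,
    so only the derivation terms of \<open>dt_F\<close> and \<open>dt_G\<close> survive.\<close>
  then show ?thesis
    by (simp add: dt_F dt_G m_G_subst nc_dt_embed nc_subst_zero[OF F0] nc_subst_zero[OF G0])
qed

end
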